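(* Let $x_0\in\mathbb{R}^{n_x}$ be an initial condition and $u$ be an input trajectory. Then $u$ is a weakly persistent input trajectory at $x_0$ if and only if there exists $T>0$ such that for any $t\ge T$ there exists $R_t>0$ such that for any $\xi_1\in\overline{B}(x(t-T),R_t)$ the optimisation problem $$\inf_{\xi_2\in\mathbb{R}^{n_x}}l(t-T,t,\xi_1,\xi_2,u)$$ admits a global solution at $\xi_1$ that is unique on $\overline{B}(x(t-T),R_t)$. In particular, in this case, $x(t-T)$ is a global solution and a strict local solution of the problem $\inf_{\xi\in\mathbb{R}^{n_x}}l(t-T,t,x(t-T),\xi,u)$.
   Context: Let $n_x,n_u,n_y$ be positive integers, $\mathbb{R}^+=[0,\infty)$, $U\subset\mathbb{R}^{n_u}$, and $f:\mathbb{R}^{n_x}\times\mathbb{R}^{n_u}\to\mathbb{R}^{n_x}$, $h:\mathbb{R}^{n_x}\times\mathbb{R}^{n_u}\to\mathbb{R}^{n_y}$ be twice continuously differentiable. The system is $\dot{x}=f(x,u)$, $y=h(x,u)$. An input trajectory is a piecewise continuous map $u:\mathbb{R}^+\to U$. Solutions are assumed to be uniquely defined at all times; $\phi_f(s_2;s_1,\xi,u)$ is the solution at time $s_2\ge s_1\ge 0$ starting from $\xi$ at time $s_1$ with input $u$. The reference trajectory is $x(t)=\phi_f(t;0,x_0,u)$. $\|\cdot\|$ is the Euclidean norm; $\overline{B}(a,R)$ is the closed Euclidean ball. Cumulative output error: $l(t_1,t_2,\xi_1,\xi_2,u)=\int_{t_1}^{t_2}\|h(\phi_f(s;t_1,\xi_1,u),u(s))-h(\phi_f(s;t_1,\xi_2,u),u(s))\|^2\,\mathrm{d}s$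 for $0\le t_1\le t_2$. A $\mathcal{K}$-function is a continuous strictly increasing $\kappa:\mathbb{R}^+\to\mathbb{R}$ with $\kappa(0)=0$. $u$ is weakly persistent at $x_0$ if there exists $T>0$ such that for any $t\ge T$ there exist $R_t>0$ and a $\mathcal{K}$-function $\kappa_t$ such that for any $\xi_1,\xi_2\in\overline{B}(x(t-T),R_t)$: $l(t-T,t,\xi_1,\xi_2,u)\ge\kappa_t(\|\xi_1-\xi_2\|)$. For $\inf_{\xi\in\mathbb{R}^{n_x}}F(\xi)$: $\xi^*$ is a global solution if $F(\xi^* )\le F(\xi)$ for all $\xi\in\mathbb{R}^{n_x}$; it is a strict local solution if it has a neighbourhood $\mathbb{U}$ with $F(\xi^* )<F(\xi)$ for all $\xi\in\mathbb{U}\setminus\{\xi^*\}$. *)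

theory Defs
  imports "HOL-Analysis.Analysis"
begin

definition twice_continuously_differentiable ::
    "('a::real_normed_vector \<Rightarrow> 'b::real_normed_vector) \<Rightarrow> bool" where
  "twice_continuously_differentiable g \<longleftrightarrow>
     (\<exists>(g' :: 'a \<Rightarrow> 'a \<Rightarrow>\<^sub>L 'b) (g'' :: 'a \<Rightarrow> 'a \<Rightarrow>\<^sub>L ('a \<Rightarrow>\<^sub>L 'b)).
        (\<forall>z. (g has_derivative blinfun_apply (g' z)) (at z)) \<and>
        (\<forall>z. (g' has_derivative blinfun_apply (g'' z)) (at z)) \<and>
        continuous_on UNIV g'')"

text \<open>
  Functions of time are total on \<^typ>\<open>real\<close>; only their values on \<open>[0, \<infinity>)\<close> matter.
  As usual, piecewise continuity means that every bounded interval contains at most finitely many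
  discontinuities and that the (finite) one-sided limits exist at each of them.
\<close>

definition piecewise_continuous :: "(real \<Rightarrow> 'a::topological_space) \<Rightarrow> bool" where
  "piecewise_continuous u \<longleftrightarrow>
     (\<forall>b\<ge>0. \<exists>D. finite D \<and> D \<subseteq> {0..b} \<and>
        (\<forall>t\<in>{0..b} - D. continuous (at t within {0..}) u) \<and>
        (\<forall>t\<in>D. (0 < t \<longrightarrow> (\<exists>l. (u \<longlongrightarrow> l) (at_left t))) \<and> (\<exists>r. (u \<longlongrightarrow> r) (at_right t))))"

definition input_trajectory :: "'u::topological_space set \<Rightarrow> (real \<Rightarrow> 'u) \<Rightarrow> bool" where
  "input_trajectory U u \<longleftrightarrow> (\<forall>t\<ge>0. u t \<in> U) \<and> piecewise_continuous u"

text \<open>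
  A solution on \<open>[s\<^sub>1, \<infinity>)\<close> is continuous and satisfies the differential equation
  wherever the input is continuous; at a jump of \<open>u\<close> no two-sided derivative can be expected.
\<close>

definition solution ::
    "('x::real_normed_vector \<times> 'u::topological_space \<Rightarrow> 'x) \<Rightarrow> real \<Rightarrow> 'x \<Rightarrow> (real \<Rightarrow> 'u)
      \<Rightarrow> (real \<Rightarrow> 'x) \<Rightarrow> bool" where
  "solution f s\<^sub>1 \<xi> u x \<longleftrightarrow>
     x s\<^sub>1 = \<xi> \<and> continuous_on {s\<^sub>1..} x \<and>
     (\<forall>s\<ge>s\<^sub>1. continuous (at s within {s\<^sub>1..}) u \<longrightarrow>
        (x has_vector_derivative f (x s, u s)) (at s within {s\<^sub>1..}))"

definition solutions_uniquely_defined ::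
    "('x::real_normed_vector \<times> 'u::topological_space \<Rightarrow> 'x) \<Rightarrow> 'u set \<Rightarrow> bool" where
  "solutions_uniquely_defined f U \<longleftrightarrow>
     (\<forall>u s\<^sub>1 \<xi>. input_trajectory U u \<longrightarrow> 0 \<le> s\<^sub>1 \<longrightarrow>
        (\<exists>x. solution f s\<^sub>1 \<xi> u x \<and>
             (\<forall>y. solution f s\<^sub>1 \<xi> u y \<longrightarrow> (\<forall>s\<ge>s\<^sub>1. y s = x s))))"

definition flow ::
    "('x::real_normed_vector \<times> 'u::topological_space \<Rightarrow> 'x) \<Rightarrow> real \<Rightarrow> real \<Rightarrow> 'x
      \<Rightarrow> (real \<Rightarrow> 'u) \<Rightarrow> 'x" where
  "flow f s\<^sub>2 s\<^sub>1 \<xi> u = (THE z. \<exists>x. solution f s\<^sub>1 \<xi> u x \<and> z = x s\<^sub>2)"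

definition output_error ::
    "('x::real_normed_vector \<times> 'u::topological_space \<Rightarrow> 'x) \<Rightarrow> ('x \<times> 'u \<Rightarrow> 'y::real_normed_vector)
      \<Rightarrow> real \<Rightarrow> real \<Rightarrow> 'x \<Rightarrow> 'x \<Rightarrow> (real \<Rightarrow> 'u) \<Rightarrow> real" where
  "output_error f h t\<^sub>1 t\<^sub>2 \<xi>\<^sub>1 \<xi>\<^sub>2 u =
     integral {t\<^sub>1..t\<^sub>2}
       (\<lambda>s. (norm (h (flow f s t\<^sub>1 \<xi>\<^sub>1 u, u s) - h (flow f s t\<^sub>1 \<xi>\<^sub>2 u, u s)))\<^sup>2)"

definition K_function :: "(real \<Rightarrow> real) \<Rightarrow> bool" where
  "K_function \<kappa> \<longleftrightarrow> continuous_on {0..} \<kappa> \<and> strict_mono_on {0..} \<kappa> \<and> \<kappa> 0 = 0"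

definition weakly_persistent ::
    "('x::real_normed_vector \<times> 'u::topological_space \<Rightarrow> 'x) \<Rightarrow> ('x \<times> 'u \<Rightarrow> 'y::real_normed_vector)
      \<Rightarrow> 'x \<Rightarrow> (real \<Rightarrow> 'u) \<Rightarrow> bool" where
  "weakly_persistent f h x\<^sub>0 u \<longleftrightarrow>
     (\<exists>T>0. \<forall>t\<ge>T. \<exists>R>0. \<exists>\<kappa>. K_function \<kappa> \<and>
        (\<forall>\<xi>\<^sub>1\<in>cball (flow f (t - T) 0 x\<^sub>0 u) R. \<forall>\<xi>\<^sub>2\<in>cball (flow f (t - T) 0 x\<^sub>0 u) R.
           output_error f h (t - T) t \<xi>\<^sub>1 \<xi>\<^sub>2 u \<ge> \<kappa> (norm (\<xi>\<^sub>1 - \<xi>\<^sub>2))))"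

definition global_solution :: "('a \<Rightarrow> real) \<Rightarrow> 'a \<Rightarrow> bool" where
  "global_solution F \<xi> \<longleftrightarrow> (\<forall>\<zeta>. F \<xi> \<le> F \<zeta>)"

definition strict_local_solution :: "('a::topological_space \<Rightarrow> real) \<Rightarrow> 'a \<Rightarrow> bool" where
  "strict_local_solution F \<xi> \<longleftrightarrow> (\<exists>V. open V \<and> \<xi> \<in> V \<and> (\<forall>\<zeta>\<in>V - {\<xi>}. F \<xi> < F \<zeta>))"

end

theory Submission
  imports Defs
begin

text \<open>
  The output error is nonnegative and vanishes on the diagonal, so \<open>\<xi>\<^sub>1\<close> is always a global
  solution and the other global solutions are the zeros of \<open>l(t - T, t, \<xi>\<^sub>1, \<cdot>, u)\<close>. Weak persistence
  therefore gives uniqueness on the ball at once. Conversely, by Gronwall's inequality and dominated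
  convergence \<open>l\<close> is continuous in \<open>(\<xi>\<^sub>1, \<xi>\<^sub>2)\<close>; on the compact set of pairs in the ball it
  vanishes only on the diagonal, and an infimal convolution of \<open>l\<close> with the distance
  \<open>\<parallel>\<xi>\<^sub>1 - \<xi>\<^sub>2\<parallel>\<close> turns this into a lower bound by a \<open>\<K>\<close>-function.
\<close>

section \<open>Lower bounds by K-functions\<close>

text \<open>The natural candidate, the infimum of \<open>F\<close> over the points with
  \<open>d p \<ge> r\<close>, may jump in \<open>r\<close>. Replacing the constraint by a penalty of
  slope 1 makes the infimum 1-Lipschitz in \<open>r\<close>, and compactness, through attained
  minima, keeps it positive for \<open>r > 0\<close>.\<close>

lemma K_function_lower_bound:
  fixes F d :: "'a::topological_space \<Rightarrow> real"
  assumes "compact C" "C \<noteq> {}" and contF: "continuous_on C F" and contd: "continuous_on C d"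
    and F0: "\<And>p. p \<in> C \<Longrightarrow> 0 \<le> F p" and d0: "\<And>p. p \<in> C \<Longrightarrow> 0 \<le> d p"
    and zero: "\<And>p. p \<in> C \<Longrightarrow> F p = 0 \<Longrightarrow> d p = 0"
  shows "\<exists>\<kappa>. K_function \<kappa> \<and> (\<forall>p\<in>C. \<kappa> (d p) \<le> F p)"
proof -
  \<comment> \<open>The penalty vanishes at \<open>r = d p\<close>, which yields
    \<open>m (d p) \<le> F p\<close> at the end.\<close>
  define G where "G r p = F p + max 0 (r - d p)" for r p
  define m where "m r = (INF p\<in>C. G r p)" for r
  have attained: "\<exists>p\<in>C. m r = G r p \<and> (\<forall>q\<in>C. G r p \<le> G r q)" for r
  proof -
    have "continuous_on C (G r)"
      unfolding G_def by (intro continuous_intros contF contd)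
    then obtain p where p: "p \<in> C" "\<And>q. q \<in> C \<Longrightarrow> G r p \<le> G r q"
      using continuous_attains_inf[of C "G r"] assms(1,2) by blast
    then have "m r = G r p"
      unfolding m_def by (intro cInf_eq_minimum) auto
    with p show ?thesis by blast
  qed
  have le: "m r \<le> G r q" if "q \<in> C" for r q
    using attained[of r] that by auto
  have mono: "m r \<le> m s" if "r \<le> s" for r s
  proof -
    obtain p where p: "p \<in> C" "m s = G s p" using attained by blast
    with le[of p r] that show ?thesis by (auto simp: G_def)
  qed
  have lip: "m r \<le> m s + \<bar>r - s\<bar>" for r s
  proof -
    obtain p where p: "p \<in> C" "m s = G s p" using attained by blast
    with le[of p r] show ?thesis by (auto simp: G_def)
  qed
  have pos: "0 < m r" if "0 < r" for r
  proof -
    obtain p where p: "p \<in> C" "m r = G r p" using attained by blast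
    \<comment> \<open>If \<open>F p = 0\<close>, then \<open>d p = 0\<close> and the penalty alone
      contributes \<open>r\<close>.\<close>
    have "0 < G r p"
      using F0[OF p(1)] zero[OF p(1)] that by (cases "F p = 0") (auto simp: G_def)
    with p show ?thesis by simp
  qed
  have nonneg: "0 \<le> m r" for r
  proof -
    obtain p where p: "p \<in> C" "m r = G r p" using attained by blast
    with F0[of p] show ?thesis by (auto simp: G_def)
  qed
  have contm: "continuous_on {0..} m"
    unfolding continuous_on_iff dist_real_def
  proof (intro ballI allI impI)
    fix r e :: real assume "0 < e"
    have "\<bar>m s - m r\<bar> < e" if "\<bar>s - r\<bar> < e" for s
      using lip[of s r] lip[of r s] that by linarith
    with \<open>0 < e\<close> show "\<exists>\<delta>>0. \<forall>s\<in>{0..}. \<bar>s - r\<bar> < \<delta> \<longrightarrow> \<bar>m s - m r\<bar> < e" by blast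
  qed
  \<comment> \<open>\<open>m\<close> is only nondecreasing, and \<open>m 0\<close> is positive when
    \<open>F\<close> has no zero on \<open>C\<close>. The factor \<open>r / (1 + r)\<close> is
    strictly increasing, vanishes at 0 and stays below 1, so it supplies strictness and the value 0
    without spoiling the upper bound by \<open>m\<close>.\<close>
  define \<kappa> where "\<kappa> r = m r * (r / (1 + r))" for r
  have "continuous_on {0..} \<kappa>"
    unfolding \<kappa>_def by (intro continuous_intros contm) auto
  moreover have "strict_mono_on {0..} \<kappa>"
  proof (rule strict_mono_onI)
    fix r s :: real assume rs: "r \<in> {0..}" "s \<in> {0..}" "r < s"
    have "\<kappa> r \<le> m s * (r / (1 + r))"
      unfolding \<kappa>_def using rs mono[of r s] by (intro mult_right_mono) auto
    also have "\<dots> < \<kappa> s"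
      unfolding \<kappa>_def using rs pos[of s]
      by (intro mult_strict_left_mono) (auto simp: field_simps)
    finally show "\<kappa> r < \<kappa> s" .
  qed
  moreover have "\<kappa> 0 = 0" by (simp add: \<kappa>_def)
  moreover have "\<kappa> (d p) \<le> F p" if "p \<in> C" for p
  proof -
    have "\<kappa> (d p) \<le> m (d p) * 1"
      unfolding \<kappa>_def using d0[OF that] nonneg by (intro mult_left_mono) (auto simp: field_simps)
    also have "\<dots> \<le> F p" using le[OF that, of "d p"] by (simp add: G_def)
    finally show ?thesis .
  qed
  ultimately show ?thesis unfolding K_function_def by blast
qed

section \<open>Gronwall's inequality with finitely many exceptional points\<close>

text \<open>The product of \<open>w\<close> with \<open>exp (- c * (s - a))\<close> has nonpositive
  derivative off \<open>D\<close>. Being continuous, it is still recovered from that derivative by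
  the fundamental theorem of calculus, so it cannot increase. In the application \<open>D\<close>
  contains the jumps of the input.\<close>

lemma gronwall_finite_exceptions:
  fixes w w' :: "real \<Rightarrow> real"
  assumes "finite D" and cont: "continuous_on {a..b} w"
    and deriv: "\<And>s. s \<in> {a<..<b} - D \<Longrightarrow> (w has_real_derivative w' s) (at s)"
    and bound: "\<And>s. s \<in> {a<..<b} - D \<Longrightarrow> w' s \<le> c * w s"
    and t: "t \<in> {a..b}"
  shows "w t \<le> w a * exp (c * (t - a))"
proof -
  define v where "v s = w s * exp (- c * (s - a))" for s
  \<comment> \<open>The value 0 at the exceptional points makes \<open>v'\<close> nonpositive
    everywhere, so that integrals can be compared pointwise.\<close>
  define v' where "v' s = (if s \<in> {a<..<b} - D then (w' s - c * w s) * exp (- c * (s - a)) else 0)" for s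
  have "(v' has_integral (v t - v a)) {a..t}"
  proof (rule fundamental_theorem_of_calculus_interior_strong[OF \<open>finite D\<close>])
    show "a \<le> t" using t by simp
    show "continuous_on {a..t} v"
      unfolding v_def using t by (intro continuous_intros continuous_on_subset[OF cont]) auto
    fix s assume "s \<in> {a<..<t} - D"
    then have s: "s \<in> {a<..<b} - D" using t by auto
    have "(v has_real_derivative v' s) (at s)"
      unfolding v_def[abs_def] using s
      by (auto intro!: derivative_eq_intros deriv simp: v'_def algebra_simps)
    then show "(v has_vector_derivative v' s) (at s)"
      by (simp add: has_real_derivative_iff_has_vector_derivative)
  qed
  moreover have "v' s \<le> 0" for s
    using bound[of s] by (auto simp: v'_def mult_le_0_iff)
  ultimately have "v t \<le> v a"
    using has_integral_le[of v' "v t - v a" "{a..t}" "\<lambda>_. 0" 0] by auto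
  then have "v t * exp (c * (t - a)) \<le> v a * exp (c * (t - a))"
    by (intro mult_right_mono) auto
  then show ?thesis
    by (simp add: v_def mult.assoc flip: exp_add)
qed

section \<open>Piecewise continuous inputs\<close>

text \<open>Boundedness is local: near a point off \<open>D\<close> it follows from continuity, near
  a point of \<open>D\<close> from the two one-sided limits. Compactness of the interval then gives
  a finite subcover.\<close>

lemma piecewise_continuous_bounded:
  fixes u :: "real \<Rightarrow> 'a::metric_space"
  assumes "piecewise_continuous u"
  shows "bounded (u ` {0..b})"
proof (cases "0 \<le> b")
  case True
  then obtain D where cont: "\<And>t. t \<in> {0..b} - D \<Longrightarrow> continuous (at t within {0..}) u"
    and lim: "\<And>t. t \<in> D \<Longrightarrow> (0 < t \<longrightarrow> (\<exists>l. (u \<longlongrightarrow> l) (at_left t))) \<and> (\<exists>r. (u \<longlongrightarrow> r) (at_right t))"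
    using assms unfolding piecewise_continuous_def by metis
  have near: "\<forall>\<^sub>F s in F. dist l (u s) < 1" if "(u \<longlongrightarrow> l) F" for l F
    using tendstoD[OF that, of 1] by (simp add: dist_commute)
  have local: "\<exists>V. open V \<and> t \<in> V \<and> bounded (u ` (V \<inter> {0..b}))" if t: "t \<in> {0..b}" for t
  proof (cases "t \<in> D")
    case False
    with near[of "u t" "at t within {0..}"] cont t
    have "\<forall>\<^sub>F s in at t within {0..}. dist (u t) (u s) < 1"
      by (auto simp: continuous_within)
    then obtain V where V: "open V" "t \<in> V" "\<And>s. s \<in> V \<Longrightarrow> s \<noteq> t \<Longrightarrow> s \<in> {0..} \<Longrightarrow> dist (u t) (u s) < 1"
      unfolding eventually_at_topological by blast
    have "u ` (V \<inter> {0..b}) \<subseteq> insert (u t) (ball (u t) 1)" using V(3) by force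
    with V show ?thesis by (meson bounded_ball bounded_insert bounded_subset)
  next
    case True
    obtain r where "(u \<longlongrightarrow> r) (at_right t)" using lim True by blast
    from near[OF this] obtain V where V: "open V" "t \<in> V" "\<And>s. s \<in> V \<Longrightarrow> s > t \<Longrightarrow> dist r (u s) < 1"
      unfolding eventually_at_topological by (metis greaterThan_iff less_irrefl)
    have "\<exists>l W. open W \<and> t \<in> W \<and> (\<forall>s\<in>W. 0 \<le> s \<longrightarrow> s < t \<longrightarrow> dist l (u s) < 1)"
    proof (cases "0 < t")
      case True
      with lim \<open>t \<in> D\<close> obtain l where "(u \<longlongrightarrow> l) (at_left t)" by blast
      from near[OF this] show ?thesis
        unfolding eventually_at_topological by (metis lessThan_iff less_irrefl)
    next
      case False
      \<comment> \<open>Here \<open>t = 0\<close>, and no \<open>s\<close> satisfies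
        \<open>0 \<le> s < t\<close>, so any \<open>l\<close> and \<open>W\<close> serve.\<close>
      then show ?thesis by (intro exI[of _ undefined] exI[of _ UNIV]) auto
    qed
    then obtain l W where W: "open W" "t \<in> W" "\<And>s. s \<in> W \<Longrightarrow> 0 \<le> s \<Longrightarrow> s < t \<Longrightarrow> dist l (u s) < 1"
      by blast
    have "u s \<in> insert (u t) (ball l 1 \<union> ball r 1)" if "s \<in> (V \<inter> W) \<inter> {0..b}" for s
      using V(3)[of s] W(3)[of s] that by (cases s t rule: linorder_cases) auto
    then have "u ` ((V \<inter> W) \<inter> {0..b}) \<subseteq> insert (u t) (ball l 1 \<union> ball r 1)" by blast
    then have "bounded (u ` ((V \<inter> W) \<inter> {0..b}))"
      by (rule bounded_subset[rotated]) auto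
    with V(1,2) W(1,2) show ?thesis by (meson IntI open_Int)
  qed
  then obtain V where V: "\<And>t. t \<in> {0..b} \<Longrightarrow> open (V t)" "\<And>t. t \<in> {0..b} \<Longrightarrow> t \<in> V t"
    "\<And>t. t \<in> {0..b} \<Longrightarrow> bounded (u ` (V t \<inter> {0..b}))"
    by metis
  have "{0..b} \<subseteq> (\<Union>t\<in>{0..b}. V t)" using V(2) by blast
  then obtain I where I: "I \<subseteq> {0..b}" "finite I" "{0..b} \<subseteq> (\<Union>t\<in>I. V t)"
    using compactE_image[OF compact_Icc[of 0 b], of "{0..b}" V] V(1) by auto
  have "bounded (\<Union>t\<in>I. u ` (V t \<inter> {0..b}))"
    using I V(3) by (intro bounded_UN) auto
  moreover have "u ` {0..b} \<subseteq> (\<Union>t\<in>I. u ` (V t \<inter> {0..b}))" using I(3) by blast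
  ultimately show ?thesis by (rule bounded_subset)
qed simp

text \<open>Off \<open>D\<close> the function is measurable by continuity and dominated by a
  constant; the finite set \<open>D\<close> is negligible.\<close>

lemma integrable_on_bounded_finite_exceptions:
  fixes g :: "real \<Rightarrow> 'a::euclidean_space"
  assumes "finite D" and cont: "continuous_on ({a..b} - D) g"
    and bound: "\<And>s. s \<in> {a..b} \<Longrightarrow> norm (g s) \<le> B"
  shows "g integrable_on {a..b}"
proof -
  have D: "D \<in> sets lebesgue"
    using \<open>finite D\<close> by (simp add: finite_imp_closed borel_closed)
  have "g integrable_on ({a..b} - D)"
  proof (rule measurable_bounded_by_integrable_imp_integrable)
    show "g \<in> borel_measurable (lebesgue_on ({a..b} - D))"
      using D by (intro continuous_imp_measurable_on_sets_lebesgue[OF cont]) auto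
    show "(\<lambda>_. B) integrable_on {a..b} - D"
      by (rule integrable_spike_set[of _ "{a..b}"])
        (auto intro: negligible_subset[OF negligible_finite[OF \<open>finite D\<close>]])
  qed (use D bound in auto)
  then show ?thesis
    by (rule integrable_spike_set)
      (auto intro: negligible_subset[OF negligible_finite[OF \<open>finite D\<close>]])
qed

section \<open>The flow\<close>

lemma twice_continuously_differentiable_continuous:
  "twice_continuously_differentiable g \<Longrightarrow> continuous_on UNIV g"
  unfolding twice_continuously_differentiable_def
  by (meson continuous_at_imp_continuous_on has_derivative_continuous)

text \<open>The first derivative is itself differentiable, hence continuous and bounded on the
  compact product of balls. That product is also convex, so the mean value inequality applies, with
  one constant for all inputs \<open>v\<close> in the ball.\<close>

lemma twice_continuously_differentiable_lipschitz:
  fixes f :: "'x::euclidean_space \<times> 'u::euclidean_space \<Rightarrow> 'y::real_normed_vector"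
  assumes "twice_continuously_differentiable f"
  obtains L where "0 \<le> L"
    "\<And>p q v. norm p \<le> M \<Longrightarrow> norm q \<le> M \<Longrightarrow> norm v \<le> N \<Longrightarrow> norm (f (p, v) - f (q, v)) \<le> L * norm (p - q)"
proof -
  obtain f' :: "'x \<times> 'u \<Rightarrow> ('x \<times> 'u) \<Rightarrow>\<^sub>L 'y" and f'' :: "'x \<times> 'u \<Rightarrow> ('x \<times> 'u) \<Rightarrow>\<^sub>L (('x \<times> 'u) \<Rightarrow>\<^sub>L 'y)"
    where f': "\<And>z. (f has_derivative blinfun_apply (f' z)) (at z)"
      and f'': "\<And>z. (f' has_derivative blinfun_apply (f'' z)) (at z)"
    using assms unfolding twice_continuously_differentiable_def by blast
  define K where "K = cball (0::'x) M \<times> cball (0::'u) N"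
  have "compact K" "convex K"
    unfolding K_def by (auto intro: compact_Times convex_Times)
  moreover have "continuous_on K f'"
    using f'' by (meson continuous_at_imp_continuous_on has_derivative_continuous)
  ultimately have "bounded (f' ` K)"
    by (intro compact_imp_bounded compact_continuous_image)
  then obtain L where L: "0 < L" "\<And>z. z \<in> K \<Longrightarrow> norm (f' z) \<le> L"
    unfolding bounded_pos by auto
  show ?thesis
  proof (rule that[of L])
    fix p q :: 'x and v :: 'u assume "norm p \<le> M" "norm q \<le> M" "norm v \<le> N"
    then have "(p, v) \<in> K" "(q, v) \<in> K" by (auto simp: K_def)
    then have "norm (f (p, v) - f (q, v)) \<le> L * norm ((p, v) - (q, v))"
      using L(2) \<open>convex K\<close>
      by (intro differentiable_bound[of K f "\<lambda>z. blinfun_apply (f' z)"])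
        (auto simp: norm_blinfun.rep_eq intro: has_derivative_at_withinI[OF f'])
    then show "norm (f (p, v) - f (q, v)) \<le> L * norm (p - q)"
      by (simp add: norm_Pair)
  qed (use L in simp)
qed

lemma flow_solution:
  assumes "solutions_uniquely_defined f U" "input_trajectory U u" "0 \<le> s\<^sub>1"
  shows "solution f s\<^sub>1 \<xi> u (\<lambda>s. flow f s s\<^sub>1 \<xi> u)"
proof -
  obtain X where X: "solution f s\<^sub>1 \<xi> u X"
    and uniq: "\<And>y s. solution f s\<^sub>1 \<xi> u y \<Longrightarrow> s \<ge> s\<^sub>1 \<Longrightarrow> y s = X s"
    using assms unfolding solutions_uniquely_defined_def by blast
  \<comment> \<open>Before \<open>s\<^sub>1\<close> solutions are unconstrained, so
    \<open>THE\<close> has a determined value only from \<open>s\<^sub>1\<close> on. The derivative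
    is accordingly transferred within \<open>{s\<^sub>1..}\<close>.\<close>
  have eq: "flow f s s\<^sub>1 \<xi> u = X s" if "s\<^sub>1 \<le> s" for s
    unfolding flow_def
  proof (rule the_equality)
    show "\<exists>x. solution f s\<^sub>1 \<xi> u x \<and> X s = x s" using X by blast
    show "z = X s" if "\<exists>x. solution f s\<^sub>1 \<xi> u x \<and> z = x s" for z
      using that uniq \<open>s\<^sub>1 \<le> s\<close> by blast
  qed
  show ?thesis
    unfolding solution_def
  proof (intro conjI allI impI)
    show "flow f s\<^sub>1 s\<^sub>1 \<xi> u = \<xi>"
      using X eq by (simp add: solution_def)
    show "continuous_on {s\<^sub>1..} (\<lambda>s. flow f s s\<^sub>1 \<xi> u)"
      using X eq by (subst continuous_on_cong[of _ "{s\<^sub>1..}" _ X]) (auto simp: solution_def)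
    fix s assume s: "s\<^sub>1 \<le> s" "continuous (at s within {s\<^sub>1..}) u"
    then have "(X has_vector_derivative f (X s, u s)) (at s within {s\<^sub>1..})"
      using X by (simp add: solution_def)
    then show "((\<lambda>s. flow f s s\<^sub>1 \<xi> u) has_vector_derivative f (flow f s s\<^sub>1 \<xi> u, u s)) (at s within {s\<^sub>1..})"
      using s eq by (auto intro: has_vector_derivative_transform)
  qed
qed

lemma input_trajectory_exceptions:
  assumes "input_trajectory U u" "0 \<le> b"
  obtains D where "finite D" "\<And>s. s \<in> {0..b} - D \<Longrightarrow> continuous (at s within {0..}) u"
  using assms unfolding input_trajectory_def piecewise_continuous_def by metis

text \<open>Since \<open>f\<close> is only locally Lipschitz, Gronwall's inequality first needs the
  perturbed solution to stay within distance 1 of the reference solution. Starting within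
  \<open>1 / E\<close>, where \<open>E\<close> is the Gronwall factor, it never leaves this tube, by
  a first exit time argument.\<close>

lemma flow_lipschitz_near:
  fixes f :: "'x::euclidean_space \<times> 'u::euclidean_space \<Rightarrow> 'x"
  assumes f: "twice_continuously_differentiable f"
    and uniq: "solutions_uniquely_defined f U" and u: "input_trajectory U u"
    and "0 \<le> a" "a \<le> b"
  obtains \<delta> C where "0 < \<delta>" "0 \<le> C"
    "\<And>\<xi> s. \<xi> \<in> ball \<xi>\<^sub>0 \<delta> \<Longrightarrow> s \<in> {a..b} \<Longrightarrow>
      norm (flow f s a \<xi> u - flow f s a \<xi>\<^sub>0 u) \<le> C * norm (\<xi> - \<xi>\<^sub>0)"
proof -
  obtain D where "finite D" and D: "\<And>s. s \<in> {0..b} - D \<Longrightarrow> continuous (at s within {0..}) u"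
    using input_trajectory_exceptions[OF u, of b] \<open>0 \<le> a\<close> \<open>a \<le> b\<close> by auto
  define X where "X \<xi> s = flow f s a \<xi> u" for \<xi> s
  have sol: "solution f a \<xi> u (X \<xi>)" for \<xi>
    unfolding X_def by (rule flow_solution[OF uniq u \<open>0 \<le> a\<close>])
  have init: "X \<xi> a = \<xi>" and contX: "continuous_on {a..b} (X \<xi>)" for \<xi>
    using sol[of \<xi>] by (auto simp: solution_def intro: continuous_on_subset)
  have deriv: "(X \<xi> has_vector_derivative f (X \<xi> s, u s)) (at s)" if "s \<in> {a<..<b} - D" for \<xi> s
  proof -
    have "continuous (at s within {0..}) u" using D that \<open>0 \<le> a\<close> by auto
    then have "continuous (at s within {a..}) u"
      by (rule continuous_within_subset) (use \<open>0 \<le> a\<close> in auto)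
    then have "(X \<xi> has_vector_derivative f (X \<xi> s, u s)) (at s within {a..})"
      using sol[of \<xi>] that by (simp add: solution_def)
    then have "(X \<xi> has_vector_derivative f (X \<xi> s, u s)) (at s within {a<..<b})"
      by (rule has_vector_derivative_within_subset) auto
    then show ?thesis using that by (simp add: at_within_open[of s "{a<..<b}"])
  qed
  have "bounded (X \<xi>\<^sub>0 ` {a..b})"
    by (intro compact_imp_bounded compact_continuous_image contX) auto
  then obtain M where M: "\<And>s. s \<in> {a..b} \<Longrightarrow> norm (X \<xi>\<^sub>0 s) \<le> M"
    unfolding bounded_iff by blast
  have "bounded (u ` {0..b})"
    using u by (intro piecewise_continuous_bounded) (simp add: input_trajectory_def)
  then obtain N where N: "\<And>s. s \<in> {0..b} \<Longrightarrow> norm (u s) \<le> N"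
    unfolding bounded_iff by blast
  \<comment> \<open>\<open>M + 1\<close> bounds every state within distance 1 of the reference
    solution.\<close>
  obtain L where "0 \<le> L" and L: "\<And>p q v. norm p \<le> M + 1 \<Longrightarrow> norm q \<le> M + 1 \<Longrightarrow> norm v \<le> N \<Longrightarrow>
      norm (f (p, v) - f (q, v)) \<le> L * norm (p - q)"
    using twice_continuously_differentiable_lipschitz[OF f, of "M + 1" N] by blast
  define E where "E = exp (L * (b - a))"
  have "1 \<le> E" using \<open>0 \<le> L\<close> \<open>a \<le> b\<close> by (simp add: E_def)
  \<comment> \<open>Closeness is assumed only strictly before \<open>t\<close>, so that the estimate
    can be used at the first exit time itself.\<close>
  have tube: "norm (X \<xi> t - X \<xi>\<^sub>0 t) \<le> norm (\<xi> - \<xi>\<^sub>0) * E"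
    if t: "t \<in> {a..b}" and near: "\<And>s. s \<in> {a..<t} \<Longrightarrow> norm (X \<xi> s - X \<xi>\<^sub>0 s) \<le> 1" for \<xi> t
  proof -
    define e where "e s = X \<xi> s - X \<xi>\<^sub>0 s" for s
    define e' where "e' s = f (X \<xi> s, u s) - f (X \<xi>\<^sub>0 s, u s)" for s
    \<comment> \<open>The squared norm is differentiable even where the error vanishes.
      Cauchy-Schwarz and the Lipschitz bound give it the rate \<open>2 * L\<close>; the square root
      restores the factor \<open>E\<close>.\<close>
    have "e t \<bullet> e t \<le> e a \<bullet> e a * exp (2 * L * (t - a))"
    proof (rule gronwall_finite_exceptions[OF \<open>finite D\<close>, of a t _ "\<lambda>s. 2 * (e s \<bullet> e' s)"])
      show "continuous_on {a..t} (\<lambda>s. e s \<bullet> e s)"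
        unfolding e_def using t by (intro continuous_intros continuous_on_subset[OF contX]) auto
      fix s assume "s \<in> {a<..<t} - D"
      then have s: "s \<in> {a<..<b} - D" "s \<in> {a..<t}" using t by auto
      have "(e has_vector_derivative e' s) (at s)"
        unfolding e_def[abs_def] e'_def by (intro has_vector_derivative_diff deriv s)
      then have "((\<lambda>s. e s \<bullet> e s) has_derivative (\<lambda>h. e s \<bullet> (h *\<^sub>R e' s) + (h *\<^sub>R e' s) \<bullet> e s)) (at s)"
        unfolding has_vector_derivative_def by (intro has_derivative_inner)
      moreover have "(\<lambda>h. e s \<bullet> (h *\<^sub>R e' s) + (h *\<^sub>R e' s) \<bullet> e s) = (*) (2 * (e s \<bullet> e' s))"
        by (auto simp: inner_commute algebra_simps)
      ultimately show "((\<lambda>s. e s \<bullet> e s) has_real_derivative 2 * (e s \<bullet> e' s)) (at s)"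
        by (simp add: has_field_derivative_def)
      have "norm (X \<xi>\<^sub>0 s) \<le> M" using M s by auto
      moreover have "norm (X \<xi> s) \<le> norm (X \<xi>\<^sub>0 s) + norm (X \<xi> s - X \<xi>\<^sub>0 s)"
        using norm_triangle_ineq[of "X \<xi>\<^sub>0 s" "X \<xi> s - X \<xi>\<^sub>0 s"] by simp
      ultimately have "norm (e' s) \<le> L * norm (e s)"
        unfolding e'_def e_def using near[OF s(2)] N[of s] s \<open>0 \<le> a\<close> by (intro L) auto
      then have "norm (e s) * norm (e' s) \<le> norm (e s) * (L * norm (e s))"
        by (intro mult_left_mono) auto
      then have "e s \<bullet> e' s \<le> L * (e s \<bullet> e s)"
        using norm_cauchy_schwarz[of "e s" "e' s"]
        by (simp add: dot_square_norm power2_eq_square mult_ac)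
      then show "2 * (e s \<bullet> e' s) \<le> 2 * L * (e s \<bullet> e s)" by simp
    qed (use t in auto)
    also have "\<dots> \<le> e a \<bullet> e a * exp (2 * L * (b - a))"
      using t \<open>0 \<le> L\<close> by (intro mult_left_mono) (auto intro!: mult_left_mono)
    also have "\<dots> = (norm (\<xi> - \<xi>\<^sub>0) * E)\<^sup>2"
      by (simp add: e_def init E_def dot_square_norm power_mult_distrib mult.assoc flip: exp_double)
    finally have "(norm (e t))\<^sup>2 \<le> (norm (\<xi> - \<xi>\<^sub>0) * E)\<^sup>2" by (simp add: dot_square_norm)
    then show ?thesis
      unfolding e_def by (rule power2_le_imp_le) (use \<open>1 \<le> E\<close> in simp)
  qed
  have stay: "norm (X \<xi> s - X \<xi>\<^sub>0 s) < 1" if \<xi>: "\<xi> \<in> ball \<xi>\<^sub>0 (1 / E)" and s: "s \<in> {a..b}" for \<xi> s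
  proof (rule ccontr)
    have small: "norm (\<xi> - \<xi>\<^sub>0) * E < 1"
      using \<xi> \<open>1 \<le> E\<close> by (simp add: field_simps dist_norm norm_minus_commute)
    \<comment> \<open>The exit times form a compact set, whose least element \<tau> is the first
      exit. Before \<tau> the error is below 1, so \<open>tube\<close> applies at \<tau> and
      contradicts \<open>small\<close>.\<close>
    define S where "S = {s \<in> {a..b}. 1 \<le> norm (X \<xi> s - X \<xi>\<^sub>0 s)}"
    assume "\<not> norm (X \<xi> s - X \<xi>\<^sub>0 s) < 1"
    then have "S \<noteq> {}" using s by (auto simp: S_def)
    moreover have "compact S"
    proof -
      have "closed S"
        unfolding S_def
        by (intro continuous_on_closed_Collect_le continuous_intros contX)
      moreover have "S \<subseteq> {a..b}" by (auto simp: S_def)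
      ultimately show ?thesis by (meson bounded_closed_interval bounded_subset compact_eq_bounded_closed)
    qed
    ultimately obtain \<tau> where \<tau>: "\<tau> \<in> S" "\<And>s. s \<in> S \<Longrightarrow> \<tau> \<le> s"
      using compact_attains_inf[of S] by blast
    have "norm (X \<xi> \<tau> - X \<xi>\<^sub>0 \<tau>) \<le> norm (\<xi> - \<xi>\<^sub>0) * E"
    proof (rule tube)
      show "\<tau> \<in> {a..b}" using \<tau> by (simp add: S_def)
      fix r assume "r \<in> {a..<\<tau>}"
      then have "r \<notin> S" "r \<in> {a..b}" using \<tau> by (force simp: S_def)+
      then show "norm (X \<xi> r - X \<xi>\<^sub>0 r) \<le> 1" by (auto simp: S_def)
    qed
    with small \<tau>(1) show False by (simp add: S_def)
  qed
  show ?thesis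
  proof (rule that[of "1 / E" E])
    fix \<xi> s assume "\<xi> \<in> ball \<xi>\<^sub>0 (1 / E)" "s \<in> {a..b}"
    then have "norm (X \<xi> s - X \<xi>\<^sub>0 s) \<le> norm (\<xi> - \<xi>\<^sub>0) * E"
      using stay by (intro tube) (auto intro!: less_imp_le)
    then show "norm (flow f s a \<xi> u - flow f s a \<xi>\<^sub>0 u) \<le> E * norm (\<xi> - \<xi>\<^sub>0)"
      by (simp add: X_def mult.commute)
  qed (use \<open>1 \<le> E\<close> in auto)
qed

section \<open>The output error\<close>

lemma output_error_nonneg: "0 \<le> output_error f h t\<^sub>1 t\<^sub>2 \<xi>\<^sub>1 \<xi>\<^sub>2 u"
  unfolding output_error_def
  \<comment> \<open>If the integrand is not integrable, \<open>integral\<close> takes its default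
    value 0.\<close>
  by (cases "(\<lambda>s. (norm (h (flow f s t\<^sub>1 \<xi>\<^sub>1 u, u s) - h (flow f s t\<^sub>1 \<xi>\<^sub>2 u, u s)))\<^sup>2) integrable_on {t\<^sub>1..t\<^sub>2}")
    (auto intro: integral_nonneg simp: not_integrable_integral)

lemma output_error_same [simp]: "output_error f h t\<^sub>1 t\<^sub>2 \<xi> \<xi> u = 0"
  by (simp add: output_error_def)

text \<open>The lower bound 0 is attained at \<open>\<xi>\<^sub>1\<close>. This turns uniqueness of
  minimisers into a separation property of the output error.\<close>

lemma global_solution_output_error_iff:
  "global_solution (\<lambda>\<xi>\<^sub>2. output_error f h t\<^sub>1 t\<^sub>2 \<xi>\<^sub>1 \<xi>\<^sub>2 u) \<xi> \<longleftrightarrow> output_error f h t\<^sub>1 t\<^sub>2 \<xi>\<^sub>1 \<xi> u = 0"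
  unfolding global_solution_def
  by (metis output_error_nonneg output_error_same order_antisym)

text \<open>Supplies what dominated convergence requires: pointwise convergence of the trajectories
  and an eventual bound uniform in time.\<close>

lemma flow_tendsto:
  fixes f :: "'x::euclidean_space \<times> 'u::euclidean_space \<Rightarrow> 'x"
  assumes "twice_continuously_differentiable f"
    and "solutions_uniquely_defined f U" "input_trajectory U u"
    and "0 \<le> a" "a \<le> b" and X: "X \<longlonglongrightarrow> \<xi>"
  obtains M where "\<And>s. s \<in> {a..b} \<Longrightarrow> (\<lambda>n. flow f s a (X n) u) \<longlonglongrightarrow> flow f s a \<xi> u"
    "\<forall>\<^sub>F n in sequentially. \<forall>s\<in>{a..b}. norm (flow f s a (X n) u) \<le> M"
proof -
  obtain \<delta> C where "0 < \<delta>" "0 \<le> C" and C: "\<And>\<zeta> s. \<zeta> \<in> ball \<xi> \<delta> \<Longrightarrow> s \<in> {a..b} \<Longrightarrow>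
      norm (flow f s a \<zeta> u - flow f s a \<xi> u) \<le> C * norm (\<zeta> - \<xi>)"
    using flow_lipschitz_near[OF assms(1-5), of \<xi>] by blast
  have near: "\<forall>\<^sub>F n in sequentially. X n \<in> ball \<xi> \<delta>"
    using tendstoD[OF X \<open>0 < \<delta>\<close>] by (simp add: dist_commute)
  have "continuous_on {a..b} (\<lambda>s. flow f s a \<xi> u)"
    using flow_solution[OF assms(2-4), of \<xi>] by (auto simp: solution_def intro: continuous_on_subset)
  then have "bounded ((\<lambda>s. flow f s a \<xi> u) ` {a..b})"
    by (intro compact_imp_bounded compact_continuous_image) auto
  then obtain M where M: "\<And>s. s \<in> {a..b} \<Longrightarrow> norm (flow f s a \<xi> u) \<le> M"
    unfolding bounded_iff by blast
  show ?thesis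
  \<comment> \<open>\<open>M\<close> bounds the limit trajectory and \<open>C * \<delta>\<close> the
    deviation of those starting in the \<delta>-ball.\<close>
  proof (rule that[of "M + C * \<delta>"])
    fix s assume s: "s \<in> {a..b}"
    have "(\<lambda>n. flow f s a (X n) u - flow f s a \<xi> u) \<longlonglongrightarrow> 0"
    proof (rule Lim_null_comparison)
      show "\<forall>\<^sub>F n in sequentially. norm (flow f s a (X n) u - flow f s a \<xi> u) \<le> C * norm (X n - \<xi>)"
        using near by eventually_elim (use C s in auto)
      show "(\<lambda>n. C * norm (X n - \<xi>)) \<longlonglongrightarrow> 0"
        using X by (intro tendsto_mult_right_zero tendsto_norm_zero) (simp add: LIM_zero)
    qed
    then show "(\<lambda>n. flow f s a (X n) u) \<longlonglongrightarrow> flow f s a \<xi> u" by (rule LIM_zero_cancel)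
  next
    show "\<forall>\<^sub>F n in sequentially. \<forall>s\<in>{a..b}. norm (flow f s a (X n) u) \<le> M + C * \<delta>"
      using near
    proof eventually_elim
      case (elim n)
      show ?case
      proof
        fix s assume s: "s \<in> {a..b}"
        have "norm (flow f s a (X n) u - flow f s a \<xi> u) \<le> C * norm (X n - \<xi>)" using C s elim by blast
        also have "\<dots> \<le> C * \<delta>"
          using elim \<open>0 \<le> C\<close> by (intro mult_left_mono) (auto simp: dist_norm norm_minus_commute)
        finally show "norm (flow f s a (X n) u) \<le> M + C * \<delta>"
          using M[OF s] norm_triangle_sub[of "flow f s a (X n) u" "flow f s a \<xi> u"] by linarith
      qed
    qed
  qed
qed

text \<open>Along a convergent sequence of pairs the integrands converge pointwise, because
  \<open>h\<close> is continuous, and are eventually bounded by one constant, because states and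
  inputs remain in a compact set. Dominated convergence gives sequential continuity.\<close>

lemma output_error_continuous:
  fixes f :: "'x::euclidean_space \<times> 'u::euclidean_space \<Rightarrow> 'x"
    and h :: "'x \<times> 'u \<Rightarrow> 'y::real_normed_vector"
  assumes f: "twice_continuously_differentiable f" and h: "continuous_on UNIV h"
    and uniq: "solutions_uniquely_defined f U" and u: "input_trajectory U u"
    and "0 \<le> a" "a \<le> b"
  shows "continuous_on C (\<lambda>p. output_error f h a b (fst p) (snd p) u)"
proof -
  obtain D where "finite D" and D: "\<And>s. s \<in> {0..b} - D \<Longrightarrow> continuous (at s within {0..}) u"
    using input_trajectory_exceptions[OF u, of b] \<open>0 \<le> a\<close> \<open>a \<le> b\<close> by auto
  have "bounded (u ` {0..b})"
    using u by (intro piecewise_continuous_bounded) (simp add: input_trajectory_def)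
  then obtain N where N: "\<And>s. s \<in> {0..b} \<Longrightarrow> norm (u s) \<le> N"
    unfolding bounded_iff by blast
  have contu: "continuous_on ({a..b} - D) u"
    unfolding continuous_on_eq_continuous_within
  proof
    fix s assume "s \<in> {a..b} - D"
    then have "continuous (at s within {0..}) u" using D \<open>0 \<le> a\<close> by auto
    then show "continuous (at s within {a..b} - D) u"
      by (rule continuous_within_subset) (use \<open>0 \<le> a\<close> in auto)
  qed
  define X where "X \<xi> s = flow f s a \<xi> u" for \<xi> s
  have contX: "continuous_on {a..b} (X \<xi>)" for \<xi>
    using flow_solution[OF uniq u \<open>0 \<le> a\<close>, of \<xi>]
    by (auto simp: solution_def X_def intro: continuous_on_subset)
  define g where "g p s = (norm (h (X (fst p) s, u s) - h (X (snd p) s, u s)))\<^sup>2" for p s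
  have hbound: "\<exists>B. \<forall>x v. norm x \<le> M \<longrightarrow> norm v \<le> N \<longrightarrow> norm (h (x, v)) \<le> B" for M
  proof -
    have "bounded (h ` (cball 0 M \<times> cball 0 N))"
      by (intro compact_imp_bounded compact_continuous_image continuous_on_subset[OF h] compact_Times) auto
    then obtain B where "\<forall>y\<in>h ` (cball 0 M \<times> cball 0 N). norm y \<le> B"
      unfolding bounded_iff by blast
    then show ?thesis by (intro exI[of _ B]) auto
  qed
  \<comment> \<open>The bound \<open>B\<close> depends on \<open>M\<close> alone, not on the pair
    \<open>p\<close>, so one constant dominates all late terms of a sequence.\<close>
  have gbound: "\<exists>B. \<forall>p s. s \<in> {a..b} \<longrightarrow> norm (X (fst p) s) \<le> M \<longrightarrow> norm (X (snd p) s) \<le> M \<longrightarrow> norm (g p s) \<le> B"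
    for M
  proof -
    obtain B where B: "\<And>x v. norm x \<le> M \<Longrightarrow> norm v \<le> N \<Longrightarrow> norm (h (x, v)) \<le> B"
      using hbound[of M] by blast
    have "norm (g p s) \<le> (2 * B)\<^sup>2"
      if "s \<in> {a..b}" "norm (X (fst p) s) \<le> M" "norm (X (snd p) s) \<le> M" for p s
    proof -
      have "norm (u s) \<le> N" using N that \<open>0 \<le> a\<close> by auto
      then have "norm (h (X (fst p) s, u s) - h (X (snd p) s, u s)) \<le> 2 * B"
        using B that norm_triangle_ineq4[of "h (X (fst p) s, u s)" "h (X (snd p) s, u s)"] by smt
      from power_mono[OF this norm_ge_zero, of 2] show ?thesis by (simp add: g_def)
    qed
    then show ?thesis by blast
  qed
  have integrable: "g p integrable_on {a..b}" for p
  proof -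
    have "bounded (X (fst p) ` {a..b} \<union> X (snd p) ` {a..b})"
      using contX by (auto intro!: compact_imp_bounded compact_continuous_image)
    then obtain M where "\<And>s. s \<in> {a..b} \<Longrightarrow> norm (X (fst p) s) \<le> M \<and> norm (X (snd p) s) \<le> M"
      unfolding bounded_iff by blast
    with gbound[of M] obtain B where "\<And>s. s \<in> {a..b} \<Longrightarrow> norm (g p s) \<le> B" by blast
    moreover have "continuous_on ({a..b} - D) (g p)"
      unfolding g_def
      by (intro continuous_intros continuous_on_compose2[OF h] contu continuous_on_subset[OF contX]) auto
    ultimately show ?thesis
      by (rule integrable_on_bounded_finite_exceptions[OF \<open>finite D\<close>, rotated])
  qed
  have "(\<lambda>n. integral {a..b} (g (P n))) \<longlonglongrightarrow> integral {a..b} (g p)" if P: "P \<longlonglongrightarrow> p" for P p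
  proof -
    obtain M1 where M1: "\<And>s. s \<in> {a..b} \<Longrightarrow> (\<lambda>n. X (fst (P n)) s) \<longlonglongrightarrow> X (fst p) s"
      "\<forall>\<^sub>F n in sequentially. \<forall>s\<in>{a..b}. norm (X (fst (P n)) s) \<le> M1"
      unfolding X_def using flow_tendsto[OF f uniq u \<open>0 \<le> a\<close> \<open>a \<le> b\<close> tendsto_fst[OF P]] by blast
    obtain M2 where M2: "\<And>s. s \<in> {a..b} \<Longrightarrow> (\<lambda>n. X (snd (P n)) s) \<longlonglongrightarrow> X (snd p) s"
      "\<forall>\<^sub>F n in sequentially. \<forall>s\<in>{a..b}. norm (X (snd (P n)) s) \<le> M2"
      unfolding X_def using flow_tendsto[OF f uniq u \<open>0 \<le> a\<close> \<open>a \<le> b\<close> tendsto_snd[OF P]] by blast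
    obtain B where B: "\<And>p s. s \<in> {a..b} \<Longrightarrow> norm (X (fst p) s) \<le> max M1 M2 \<Longrightarrow>
        norm (X (snd p) s) \<le> max M1 M2 \<Longrightarrow> norm (g p s) \<le> B"
      using gbound[of "max M1 M2"] by blast
    have "\<forall>\<^sub>F n in sequentially. \<forall>s\<in>{a..b}. norm (g (P n) s) \<le> B"
      using M1(2) M2(2) by eventually_elim (meson B max.coboundedI1 max.coboundedI2)
    then obtain n\<^sub>0 where n0: "\<And>n s. n \<ge> n\<^sub>0 \<Longrightarrow> s \<in> {a..b} \<Longrightarrow> norm (g (P n) s) \<le> B"
      unfolding eventually_sequentially by blast
    \<comment> \<open>The common bound holds only from \<open>n\<^sub>0\<close> on, hence the
      shifted sequence.\<close>
    have "(\<lambda>n. integral {a..b} (g (P (n + n\<^sub>0)))) \<longlonglongrightarrow> integral {a..b} (g p)"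
    proof (rule dominated_convergence(2)[where h = "\<lambda>_. B"])
      fix s assume s: "s \<in> {a..b}"
      have h_lim: "(\<lambda>n. h (Y n, u s)) \<longlonglongrightarrow> h (y, u s)" if "Y \<longlonglongrightarrow> y" for Y y
        using continuous_on_tendsto_compose[OF h tendsto_Pair[OF that tendsto_const]] by simp
      have "(\<lambda>n. g (P n) s) \<longlonglongrightarrow> g p s"
        unfolding g_def by (intro tendsto_intros h_lim M1 M2 s)
      then show "(\<lambda>n. g (P (n + n\<^sub>0)) s) \<longlonglongrightarrow> g p s"
        by (rule LIMSEQ_ignore_initial_segment)
    qed (use integrable n0 in auto)
    then show ?thesis by (rule LIMSEQ_offset)
  qed
  moreover have "output_error f h a b (fst p) (snd p) u = integral {a..b} (g p)" for p
    by (simp add: output_error_def g_def[abs_def] X_def)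
  ultimately show ?thesis
    unfolding continuous_on_sequentially by (simp add: o_def)
qed

section \<open>Weak persistence and uniqueness of minimisers\<close>

theorem proposition4p3:
  fixes f :: "(real ^ 'nx) \<times> (real ^ 'nu) \<Rightarrow> real ^ 'nx"
    and h :: "(real ^ 'nx) \<times> (real ^ 'nu) \<Rightarrow> real ^ 'ny"
    and U :: "(real ^ 'nu) set"
    and x\<^sub>0 :: "real ^ 'nx"
    and u :: "real \<Rightarrow> real ^ 'nu"
    and x :: "real \<Rightarrow> real ^ 'nx"
  assumes "twice_continuously_differentiable f"
    and "twice_continuously_differentiable h"
    and "solutions_uniquely_defined f U"
    and "input_trajectory U u"
    and "\<And>t. t \<ge> 0 \<Longrightarrow> x t = flow f t 0 x\<^sub>0 u"
  shows "(weakly_persistent f h x\<^sub>0 u \<longleftrightarrow>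
           (\<exists>T>0. \<forall>t\<ge>T. \<exists>R>0. \<forall>\<xi>\<^sub>1\<in>cball (x (t - T)) R.
              global_solution (\<lambda>\<xi>\<^sub>2. output_error f h (t - T) t \<xi>\<^sub>1 \<xi>\<^sub>2 u) \<xi>\<^sub>1 \<and>
              (\<forall>\<xi>\<in>cball (x (t - T)) R.
                 global_solution (\<lambda>\<xi>\<^sub>2. output_error f h (t - T) t \<xi>\<^sub>1 \<xi>\<^sub>2 u) \<xi> \<longrightarrow> \<xi> = \<xi>\<^sub>1)))
       \<and> (\<forall>T>0.
           (\<forall>t\<ge>T. \<exists>R>0. \<forall>\<xi>\<^sub>1\<in>cball (x (t - T)) R.
              global_solution (\<lambda>\<xi>\<^sub>2. output_error f h (t - T) t \<xi>\<^sub>1 \<xi>\<^sub>2 u) \<xi>\<^sub>1 \<and>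
              (\<forall>\<xi>\<in>cball (x (t - T)) R.
                 global_solution (\<lambda>\<xi>\<^sub>2. output_error f h (t - T) t \<xi>\<^sub>1 \<xi>\<^sub>2 u) \<xi> \<longrightarrow> \<xi> = \<xi>\<^sub>1)) \<longrightarrow>
           (\<forall>t\<ge>T.
              global_solution (\<lambda>\<xi>. output_error f h (t - T) t (x (t - T)) \<xi> u) (x (t - T)) \<and>
              strict_local_solution (\<lambda>\<xi>. output_error f h (t - T) t (x (t - T)) \<xi> u) (x (t - T))))"
proof -
  let ?l = "\<lambda>T t \<xi>\<^sub>1 \<xi>\<^sub>2. output_error f h (t - T) t \<xi>\<^sub>1 \<xi>\<^sub>2 u"
  \<comment> \<open>The uniqueness condition, with global solutions already rewritten as zeros of
    the output error.\<close>
  let ?sep = "\<lambda>T t R. \<forall>\<xi>\<^sub>1\<in>cball (x (t - T)) R. \<forall>\<xi>\<in>cball (x (t - T)) R. ?l T t \<xi>\<^sub>1 \<xi> = 0 \<longrightarrow> \<xi> = \<xi>\<^sub>1"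
  let ?bounded = "\<lambda>T t R. \<exists>\<kappa>. K_function \<kappa> \<and>
    (\<forall>\<xi>\<^sub>1\<in>cball (x (t - T)) R. \<forall>\<xi>\<^sub>2\<in>cball (x (t - T)) R. \<kappa> (norm (\<xi>\<^sub>1 - \<xi>\<^sub>2)) \<le> ?l T t \<xi>\<^sub>1 \<xi>\<^sub>2)"
  have "?sep T t R" if bdd: "?bounded T t R" for T t R
  proof (intro ballI impI)
    fix \<xi>\<^sub>1 \<xi> assume \<xi>: "\<xi>\<^sub>1 \<in> cball (x (t - T)) R" "\<xi> \<in> cball (x (t - T)) R" "?l T t \<xi>\<^sub>1 \<xi> = 0"
    obtain \<kappa> where "K_function \<kappa>" and "\<kappa> (norm (\<xi>\<^sub>1 - \<xi>)) \<le> ?l T t \<xi>\<^sub>1 \<xi>"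
      using bdd \<xi>(1,2) by blast
    \<comment> \<open>For distinct points strict monotonicity would give \<kappa> a value above
      \<open>\<kappa> 0 = 0\<close>, while the output error is 0.\<close>
    with \<xi>(3) show "\<xi> = \<xi>\<^sub>1"
      using strict_mono_onD[of "{0..}" \<kappa> 0 "norm (\<xi>\<^sub>1 - \<xi>)"]
      by (force simp: K_function_def)
  qed
  moreover have "?bounded T t R" if sep: "?sep T t R" and "0 < T" "T \<le> t" "0 < R" for T t R
  proof -
    let ?B = "cball (x (t - T)) R"
    have "continuous_on UNIV h"
      using assms(2) by (rule twice_continuously_differentiable_continuous)
    then have "continuous_on (?B \<times> ?B) (\<lambda>p. ?l T t (fst p) (snd p))"
      by (intro output_error_continuous[OF assms(1) _ assms(3,4)]) (use that in auto)
    moreover have "fst p = snd p" if "p \<in> ?B \<times> ?B" "?l T t (fst p) (snd p) = 0" for p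
      using sep that by (metis mem_Times_iff)
    \<comment> \<open>On pairs in the ball, \<open>F\<close> is the output error and
      \<open>d\<close> the distance of the two components; separation says that \<open>d\<close>
      vanishes where \<open>F\<close> does.\<close>
    ultimately have "\<exists>\<kappa>. K_function \<kappa> \<and> (\<forall>p\<in>?B \<times> ?B. \<kappa> (norm (fst p - snd p)) \<le> ?l T t (fst p) (snd p))"
      by (intro K_function_lower_bound)
        (use \<open>0 < R\<close> in \<open>auto intro!: compact_Times continuous_intros output_error_nonneg\<close>)
    then show ?thesis by auto
  qed
  \<comment> \<open>The equivalence holds for each \<open>T\<close>, \<open>t\<close> and
    \<open>R\<close> separately, so the same horizon and radii serve in both directions.\<close>
  ultimately have iff: "?bounded T t R \<longleftrightarrow> ?sep T t R" if "0 < T" "T \<le> t" "0 < R" for T t R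
    using that by blast
  \<comment> \<open>As \<open>t \<ge> T\<close>, the time \<open>t - T\<close> is nonnegative and
    \<open>x (t - T)\<close> is the value of the flow.\<close>
  have wp: "weakly_persistent f h x\<^sub>0 u \<longleftrightarrow> (\<exists>T>0. \<forall>t\<ge>T. \<exists>R>0. ?bounded T t R)"
    unfolding weakly_persistent_def by (auto simp: assms(5) cong: conj_cong)
  \<comment> \<open>Separation is used with \<open>\<xi>\<^sub>1\<close> at the centre of the ball;
    the open ball is the required neighbourhood.\<close>
  have "strict_local_solution (?l T t (x (t - T))) (x (t - T))" if "?sep T t R" "0 < R" for T t R
    unfolding strict_local_solution_def
  proof (intro exI[of _ "ball (x (t - T)) R"] conjI ballI)
    fix \<zeta> assume "\<zeta> \<in> ball (x (t - T)) R - {x (t - T)}"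
    then have "?l T t (x (t - T)) \<zeta> \<noteq> 0" using that by force
    then show "?l T t (x (t - T)) (x (t - T)) < ?l T t (x (t - T)) \<zeta>"
      using output_error_nonneg[of f h "t - T" t "x (t - T)" \<zeta> u] by simp
  qed (use that in auto)
  moreover have "weakly_persistent f h x\<^sub>0 u \<longleftrightarrow> (\<exists>T>0. \<forall>t\<ge>T. \<exists>R>0. ?sep T t R)"
    by (simp only: wp iff cong: conj_cong imp_cong)
  ultimately show ?thesis
    unfolding global_solution_output_error_iff by auto
qed

end
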